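(* Let $\mathsf{Q}=(\mathsf{Q},\&)$ be a commutative and unital quantale. The functor $\mathrm{pt}\colon(\mathsf{Q}\text{-}\mathsf{Mod}_{\mathsf{frm}})^{\mathrm{op}}\to\mathsf{Q}\text{-}\mathsf{Top}$ is right adjoint to the functor $\mathcal{O}\colon\mathsf{Q}\text{-}\mathsf{Top}\to(\mathsf{Q}\text{-}\mathsf{Mod}_{\mathsf{frm}})^{\mathrm{op}}$.
   Context: A commutative unital quantale $(\mathsf{Q},\&)$ is a complete lattice $\mathsf{Q}$ (bottom $0$, top $1$) with a commutative associative operation $\&$ that distributes over arbitrary joins and has a unit $k$ (not necessarily $k=1$). A $\mathsf{Q}$-module is a pair $(A,\otimes)$ with $A$ a complete lattice and $\otimes\colon\mathsf{Q}\times A\to A$ such that $k\otimes x=x$, $s\otimes(r\otimes x)=(s\& r)\otimes x$, and $\otimes$ preserves arbitrary joins in each variable separately. A homomorphism of $\mathsf{Q}$-modules is a map $f$ preserving arbitrary joins with $f(r\otimes x)=r\otimes f(x)$. $\mathsf{Q}\text{-}\mathsf{Mod}_{\mathsf{frm}}$ is the category of $\mathsf{Q}$-modules and $\mathsf{Q}$-module homomorphisms that preserve finite meets (including the empty one, i.e. the top element); such homomorphisms are called frame-like. $(\mathsf{Q},\&)$ is itself a $\mathsf{Q}$-module with action $\&$. A $\mathsf{Q}$-topology on a set $X$ is a subset of $\mathsf{Q}^X$ containing the constant map $1_X$ with value $1$ and closed under binary meets, arbitrary joins and $\lambda\mapsto\lambda\& r$ for each $r\in\mathsf{Q}$ (all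 pointwise); its elements are called open sets, and the set of open sets of a $\mathsf{Q}$-topological space $X$ is denoted $\mathcal{O}(X)$. A map $f\colon X\to Y$ is continuous if $\lambda\circ f\in\mathcal{O}(X)$ for all $\lambda\in\mathcal{O}(Y)$. $\mathsf{Q}\text{-}\mathsf{Top}$ is the category of $\mathsf{Q}$-topological spaces and continuous maps. The functor $\mathcal{O}$ sends $X$ to the $\mathsf{Q}$-module $\mathcal{O}(X)$ with action $r\otimes\lambda=\lambda\& r$, and a continuous map $f\colon X\to Y$ to $\mathcal{O}(Y)\to\mathcal{O}(X)$, $\lambda\mapsto\lambda\circ f$. A point of a $\mathsf{Q}$-module $(A,\otimes)$ is a frame-like $\mathsf{Q}$-module homomorphism $p\colon(A,\otimes)\to(\mathsf{Q},\&)$. The functor $\mathrm{pt}$ sends $(A,\otimes)$ to the set $\mathrm{pt}A$ of all points of $A$ with the $\mathsf{Q}$-topology $\widehat{A}=\{\widehat{\lambda}\mid\lambda\in A\}$, where $\widehat{\lambda}(p)=p(\lambda)$, and sends a frame-like homomorphism $f\colon A\to B$ to $\mathrm{pt}B\to\mathrm{pt}A$, $p\mapsto p\circ f$. *)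

theory Defs
  imports "HOL-Algebra.Complete_Lattice"
begin

text \<open>
  The multiplication of the quantale is written \<open>*\<close> and its unit \<open>k\<close> is the monoid unit \<open>1\<close>.
  The top element, which the literature also writes as 1, is \<open>top\<close>; it may differ from the unit.
\<close>

class comm_unital_quantale = complete_lattice + comm_monoid_mult +
  assumes mult_Sup: "r * Sup S = Sup ((\<lambda>s. r * s) ` S)"


section \<open>Modules and frame-like homomorphisms\<close>

text \<open>
  Modules and spaces are carrier-based, and their carriers may live in any type.
  Maps between them are extensional (\<open>\<rightarrow>\<^sub>E\<close>), so that equality of maps is equality on the carrier;
  accordingly, composites are formed with \<^const>\<open>compose\<close> and identities are restricted.
\<close>

record ('q, 'a) qmod = "'a gorder" +
  act :: "'q \<Rightarrow> 'a \<Rightarrow> 'a"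

locale qmodule = complete_lattice A
  for A :: "('q::comm_unital_quantale, 'a) qmod" (structure) +
  assumes act_closed: "x \<in> carrier A \<Longrightarrow> act A r x \<in> carrier A"
    and act_unit: "x \<in> carrier A \<Longrightarrow> act A 1 x = x"
    and act_act: "x \<in> carrier A \<Longrightarrow> act A s (act A r x) = act A (s * r) x"
    and act_sup: "S \<subseteq> carrier A \<Longrightarrow> act A r (\<Squnion>S) = \<Squnion>(act A r ` S)"
    and act_Sup: "x \<in> carrier A \<Longrightarrow> act A (Sup R) x = \<Squnion>((\<lambda>r. act A r x) ` R)"

definition qmod_hom ::
  "('q::comm_unital_quantale, 'a) qmod \<Rightarrow> ('q, 'b) qmod \<Rightarrow> ('a \<Rightarrow> 'b) set" where
  "qmod_hom A B = {f \<in> carrier A \<rightarrow>\<^sub>E carrier B.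
     (\<forall>S \<subseteq> carrier A. f (\<Squnion>\<^bsub>A\<^esub>S) = \<Squnion>\<^bsub>B\<^esub>(f ` S)) \<and>
     (\<forall>r. \<forall>x \<in> carrier A. f (act A r x) = act B r (f x))}"

text \<open>The morphisms of \<open>Q-Mod\<^sub>f\<^sub>r\<^sub>m\<close>. The empty meet is included below, so the top is preserved.\<close>

definition frm_hom ::
  "('q::comm_unital_quantale, 'a) qmod \<Rightarrow> ('q, 'b) qmod \<Rightarrow> ('a \<Rightarrow> 'b) set" where
  "frm_hom A B = {f \<in> qmod_hom A B.
     \<forall>S. finite S \<and> S \<subseteq> carrier A \<longrightarrow> f (\<Sqinter>\<^bsub>A\<^esub>S) = \<Sqinter>\<^bsub>B\<^esub>(f ` S)}"

definition quantale_mod :: "('q::comm_unital_quantale, 'q) qmod" where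
  "quantale_mod = \<lparr>carrier = UNIV, eq = (=), le = (\<le>), act = (*)\<rparr>"


lemma quantale_mod_sup: "\<Squnion>\<^bsub>quantale_mod\<^esub>S = Sup S"
proof -
  have "least quantale_mod x (Upper quantale_mod S) \<longleftrightarrow> x = Sup S" for x
  proof
    assume "least quantale_mod x (Upper quantale_mod S)"
    then show "x = Sup S"
      by (intro order.antisym) (auto simp: quantale_mod_def least_def Upper_def intro: Sup_upper Sup_least)
  qed (auto simp: quantale_mod_def least_def Upper_def intro: Sup_upper Sup_least)
  then show ?thesis by (simp add: Lattice.sup_def)
qed

lemma quantale_mod_inf: "\<Sqinter>\<^bsub>quantale_mod\<^esub>S = Inf S"
proof -
  have "greatest quantale_mod x (Lower quantale_mod S) \<longleftrightarrow> x = Inf S" for x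
  proof
    assume "greatest quantale_mod x (Lower quantale_mod S)"
    then show "x = Inf S"
      by (intro order.antisym) (auto simp: quantale_mod_def greatest_def Lower_def intro: Inf_lower Inf_greatest)
  qed (auto simp: quantale_mod_def greatest_def Lower_def intro: Inf_lower Inf_greatest)
  then show ?thesis by (simp add: Lattice.inf_def)
qed

lemma qmodule_quantale_mod:
  "qmodule (quantale_mod :: ('q::comm_unital_quantale, 'q) qmod)"
proof -
  have "partial_order (quantale_mod :: ('q, 'q) qmod)"
    by unfold_locales (auto simp: quantale_mod_def)
  then interpret partial_order "quantale_mod :: ('q, 'q) qmod" .
  show ?thesis
  proof
    fix S :: "'q set" and r :: 'q
    show "\<exists>s. least quantale_mod s (Upper quantale_mod S)"
      by (intro exI[of _ "Sup S"])
        (auto simp: quantale_mod_def least_def Upper_def intro: Sup_upper Sup_least)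
    show "\<exists>s. greatest quantale_mod s (Lower quantale_mod S)"
      by (intro exI[of _ "Inf S"])
        (auto simp: quantale_mod_def greatest_def Lower_def intro: Inf_lower Inf_greatest)
    show "act quantale_mod r (\<Squnion>\<^bsub>quantale_mod\<^esub>S) =
        \<Squnion>\<^bsub>quantale_mod\<^esub>(act quantale_mod r ` S)"
      unfolding quantale_mod_sup by (simp add: quantale_mod_def mult_Sup)
    show "act quantale_mod (Sup S) r = \<Squnion>\<^bsub>quantale_mod\<^esub>((\<lambda>s. act quantale_mod s r) ` S)"
      unfolding quantale_mod_sup
      using mult_Sup[of r S] by (simp add: quantale_mod_def mult.commute)
  qed (auto simp: quantale_mod_def mult.assoc)
qed


section \<open>Spaces and continuous maps\<close>

record ('q, 'x) qspace = "'x partial_object" +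
  opens :: "('x \<Rightarrow> 'q) set"

locale qtop_space =
  fixes X :: "('q::comm_unital_quantale, 'x) qspace"
  assumes opens_maps: "opens X \<subseteq> carrier X \<rightarrow>\<^sub>E UNIV"
    and opens_top: "(\<lambda>x\<in>carrier X. Orderings.top) \<in> opens X"
    and opens_inf:
      "u \<in> opens X \<Longrightarrow> v \<in> opens X \<Longrightarrow> (\<lambda>x\<in>carrier X. Lattices.inf (u x) (v x)) \<in> opens X"
    and opens_Sup: "U \<subseteq> opens X \<Longrightarrow> (\<lambda>x\<in>carrier X. Sup ((\<lambda>u. u x) ` U)) \<in> opens X"
    and opens_mult: "u \<in> opens X \<Longrightarrow> (\<lambda>x\<in>carrier X. u x * r) \<in> opens X"

definition cont_maps ::
  "('q::comm_unital_quantale, 'x) qspace \<Rightarrow> ('q, 'y) qspace \<Rightarrow> ('x \<Rightarrow> 'y) set" where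
  "cont_maps X Y =
     {f \<in> carrier X \<rightarrow>\<^sub>E carrier Y. \<forall>v \<in> opens Y. compose (carrier X) v f \<in> opens X}"


section \<open>Identities and composites\<close>

text \<open>
  Associativity and the unit laws are \<open>compose_assoc\<close>, \<open>Id_compose\<close> and
  \<open>compose_Id\<close> from the library.
\<close>

lemma id_frm_hom:
  assumes "qmodule A"
  shows "(\<lambda>a\<in>carrier A. a) \<in> frm_hom A A"
proof -
  interpret qmodule A by fact
  have im: "(\<lambda>a\<in>carrier A. a) ` S = S" if "S \<subseteq> carrier A" for S
    using that by force
  have sup: "(\<lambda>a\<in>carrier A. a) (\<Squnion>\<^bsub>A\<^esub>S) = \<Squnion>\<^bsub>A\<^esub>((\<lambda>a\<in>carrier A. a) ` S)"
    and inf: "(\<lambda>a\<in>carrier A. a) (\<Sqinter>\<^bsub>A\<^esub>S) = \<Sqinter>\<^bsub>A\<^esub>((\<lambda>a\<in>carrier A. a) ` S)"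
    if "S \<subseteq> carrier A" for S
    unfolding im[OF that] using that by simp_all
  show ?thesis
    unfolding frm_hom_def qmod_hom_def mem_Collect_eq
    using sup inf by (auto simp only: simp_thms) (simp_all add: act_closed)
qed

lemma compose_frm_hom:
  assumes "qmodule A" "f \<in> frm_hom A B" "g \<in> frm_hom B C"
  shows "compose (carrier A) g f \<in> frm_hom A C"
proof -
  interpret qmodule A by fact
  have f: "f \<in> carrier A \<rightarrow> carrier B" and g: "g \<in> carrier B \<rightarrow> carrier C"
    using assms by (auto simp: frm_hom_def qmod_hom_def)
  have im: "compose (carrier A) g f ` S = g ` f ` S" "f ` S \<subseteq> carrier B" if "S \<subseteq> carrier A" for S
    using that f by (auto simp: compose_eq image_image subset_iff intro!: image_cong)
  show ?thesis
    using assms(2,3) f g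
    by (auto simp: frm_hom_def qmod_hom_def im compose_eq act_closed Pi_iff PiE_iff)
qed

lemma id_cont_maps:
  assumes "qtop_space X"
  shows "(\<lambda>x\<in>carrier X. x) \<in> cont_maps X X"
proof -
  have "compose (carrier X) v (\<lambda>x\<in>carrier X. x) = v" if "v \<in> opens X" for v
    using qtop_space.opens_maps[OF assms] that by (intro compose_Id) (auto simp: PiE_iff)
  then show ?thesis by (auto simp: cont_maps_def)
qed

lemma compose_cont_maps:
  fixes X :: "('q::comm_unital_quantale, 'x) qspace"
    and Y :: "('q, 'y) qspace" and Z :: "('q, 'z) qspace"
  assumes "f \<in> cont_maps X Y" "g \<in> cont_maps Y Z"
  shows "compose (carrier X) g f \<in> cont_maps X Z"
proof -
  have f: "f \<in> carrier X \<rightarrow> carrier Y" and g: "g \<in> carrier Y \<rightarrow> carrier Z"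
    using assms by (auto simp: cont_maps_def)
  have "compose (carrier X) v (compose (carrier X) g f) =
      compose (carrier X) (compose (carrier Y) v g) f" for v :: "'z \<Rightarrow> 'q"
    using f by (rule compose_assoc)
  then show ?thesis
    using assms funcset_compose[OF f g] by (auto simp: cont_maps_def PiE_iff)
qed


section \<open>The functors\<close>

definition opens_mod :: "('q::comm_unital_quantale, 'x) qspace \<Rightarrow> ('q, 'x \<Rightarrow> 'q) qmod" where
  "opens_mod X = \<lparr>carrier = opens X, eq = (=),
     le = (\<lambda>u v. \<forall>x \<in> carrier X. u x \<le> v x), act = (\<lambda>r u. \<lambda>x\<in>carrier X. u x * r)\<rparr>"

text \<open>For continuous \<open>f : X \<rightarrow> Y\<close>, this is \<open>O(f) : O(Y) \<rightarrow> O(X)\<close>.\<close>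

definition opens_map ::
  "('q::comm_unital_quantale, 'x) qspace \<Rightarrow> ('q, 'y) qspace \<Rightarrow> ('x \<Rightarrow> 'y) \<Rightarrow>
     ('y \<Rightarrow> 'q) \<Rightarrow> ('x \<Rightarrow> 'q)" where
  "opens_map X Y f = (\<lambda>v\<in>opens Y. compose (carrier X) v f)"

definition points :: "('q::comm_unital_quantale, 'a) qmod \<Rightarrow> ('a \<Rightarrow> 'q) set" where
  "points A = frm_hom A quantale_mod"

definition pt :: "('q::comm_unital_quantale, 'a) qmod \<Rightarrow> ('q, 'a \<Rightarrow> 'q) qspace" where
  "pt A = \<lparr>carrier = points A, opens = (\<lambda>a. \<lambda>p\<in>points A. p a) ` carrier A\<rparr>"

text \<open>For frame-like \<open>g : A \<rightarrow> B\<close>, this is \<open>pt(g) : pt B \<rightarrow> pt A\<close>.\<close>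

definition pt_map ::
  "('q::comm_unital_quantale, 'a) qmod \<Rightarrow> ('q, 'b) qmod \<Rightarrow> ('a \<Rightarrow> 'b) \<Rightarrow>
     ('b \<Rightarrow> 'q) \<Rightarrow> ('a \<Rightarrow> 'q)" where
  "pt_map A B g = (\<lambda>p\<in>points B. compose (carrier A) p g)"


section \<open>The adjunction\<close>

text \<open>
  That \<open>pt\<close> is right adjoint to \<open>O\<close> means that the following maps are bijections natural in
  \<open>X\<close> and \<open>A\<close>: the map \<open>Hom(X, pt A) \<rightarrow> Hom(A, O(X))\<close> interchanging the two arguments. Its target is the
  hom-set from \<open>O(X)\<close> to \<open>A\<close> in the opposite of the category of modules. It is given explicitly,
  rather than as an existentially quantified family, so that one and the same family serves
  carriers of all types.
\<close>

definition adj_transpose ::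
  "('q::comm_unital_quantale, 'x) qspace \<Rightarrow> ('q, 'a) qmod \<Rightarrow> ('x \<Rightarrow> 'a \<Rightarrow> 'q) \<Rightarrow>
     ('a \<Rightarrow> 'x \<Rightarrow> 'q)" where
  "adj_transpose X A h = (\<lambda>a\<in>carrier A. \<lambda>x\<in>carrier X. h x a)"

end

theory Submission
  imports Defs
begin

text \<open>
  A continuous map \<open>X \<rightarrow> pt A\<close> and a frame-like homomorphism \<open>A \<rightarrow> O(X)\<close> are the same function of two
  arguments \<open>x \<in> X\<close>, \<open>a \<in> A\<close> with values in \<open>Q\<close>. Read either way, it must satisfy two conditions:
  for fixed \<open>x\<close> it is a point of \<open>A\<close>, and for fixed \<open>a\<close> it is an open set of \<open>X\<close>.

  For maps into \<open>pt A\<close> this is the definition of the space of points, because its open sets are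
  exactly the evaluations \<open>p \<mapsto> p a\<close>. For maps into \<open>O(X)\<close> it holds because joins, finite meets and
  the action in \<open>O(X)\<close> are computed pointwise, so that being a homomorphism can be tested at each
  \<open>x\<close> separately (\<open>frm_hom_opens_mod_iff\<close>). The transposition is therefore a bijection
  (\<open>adj_transpose_bij\<close>), and its naturality only compares composites argument by argument.

  The same pointwise criterion shows that \<open>O(f)\<close> is a homomorphism: composed with evaluation at
  \<open>x\<close> it is evaluation at \<open>f x\<close>, which is a point of \<open>O(Y)\<close>. That \<open>pt(g)\<close> is continuous holds because points
  are closed under precomposition with homomorphisms.
\<close>

section \<open>The module of open sets\<close>

lemma opens_mod_simps [simp]:
  "carrier (opens_mod X) = opens X"
  "(u \<sqsubseteq>\<^bsub>opens_mod X\<^esub> v) = (\<forall>x\<in>carrier X. u x \<le> v x)"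
  "(.=\<^bsub>opens_mod X\<^esub>) = (=)"
  "act (opens_mod X) r u = (\<lambda>x\<in>carrier X. u x * r)"
  by (simp_all add: opens_mod_def)

lemma quantale_mod_simps [simp]:
  "carrier quantale_mod = UNIV"
  "act quantale_mod = (*)"
  by (simp_all add: quantale_mod_def)

lemma (in qtop_space) opens_eqI:
  assumes "u \<in> opens X" "v \<in> opens X" "\<And>x. x \<in> carrier X \<Longrightarrow> u x = v x"
  shows "u = v"
  using PiE_ext[OF subsetD[OF opens_maps assms(1)] subsetD[OF opens_maps assms(2)]] assms(3) by blast

lemma (in qtop_space) partial_order_opens_mod: "partial_order (opens_mod X)"
  by unfold_locales (auto intro!: opens_eqI[OF _ _ order.antisym] intro: order.trans)

lemma (in qtop_space) opens_mod_sup: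
  assumes "U \<subseteq> opens X"
  shows "least (opens_mod X) (\<lambda>x\<in>carrier X. Sup ((\<lambda>u. u x) ` U)) (Upper (opens_mod X) U)"
    and "\<Squnion>\<^bsub>opens_mod X\<^esub>U = (\<lambda>x\<in>carrier X. Sup ((\<lambda>u. u x) ` U))"
proof -
  interpret partial_order "opens_mod X" by (rule partial_order_opens_mod)
  show l: "least (opens_mod X) (\<lambda>x\<in>carrier X. Sup ((\<lambda>u. u x) ` U)) (Upper (opens_mod X) U)"
    using assms opens_Sup[OF assms]
    by (auto simp: least_def Upper_def intro!: Sup_upper Sup_least)
  show "\<Squnion>\<^bsub>opens_mod X\<^esub>U = (\<lambda>x\<in>carrier X. Sup ((\<lambda>u. u x) ` U))"
    unfolding Lattice.sup_def by (rule some_equality, rule l, rule least_unique[OF _ l])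
qed

lemma (in qtop_space) opens_finite_Inf:
  assumes "finite U" "U \<subseteq> opens X"
  shows "(\<lambda>x\<in>carrier X. Inf ((\<lambda>u. u x) ` U)) \<in> opens X"
  using assms
proof (induction U rule: finite_induct)
  case empty
  then show ?case using opens_top by (simp only: image_empty Inf_empty)
next
  case (insert u U)
  then have "(\<lambda>x\<in>carrier X. Lattices.inf (u x) ((\<lambda>x\<in>carrier X. Inf ((\<lambda>u. u x) ` U)) x)) \<in> opens X"
    by (intro opens_inf) auto
  also have "(\<lambda>x\<in>carrier X. Lattices.inf (u x) ((\<lambda>x\<in>carrier X. Inf ((\<lambda>u. u x) ` U)) x)) =
      (\<lambda>x\<in>carrier X. Inf ((\<lambda>u. u x) ` insert u U))"
    by auto
  finally show ?case .
qed

text \<open>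
  Infima in \<open>O(X)\<close> need not be pointwise in general. For finite \<open>U\<close> they are, because the
  pointwise meet is then open; this is why frame-like maps into \<open>O(X)\<close> can be studied pointwise.
\<close>

lemma (in qtop_space) opens_mod_inf:
  assumes "finite U" "U \<subseteq> opens X"
  shows "\<Sqinter>\<^bsub>opens_mod X\<^esub>U = (\<lambda>x\<in>carrier X. Inf ((\<lambda>u. u x) ` U))"
proof -
  interpret partial_order "opens_mod X" by (rule partial_order_opens_mod)
  have g: "greatest (opens_mod X) (\<lambda>x\<in>carrier X. Inf ((\<lambda>u. u x) ` U)) (Lower (opens_mod X) U)"
    using assms opens_finite_Inf[OF assms]
    by (auto simp: greatest_def Lower_def intro!: Inf_lower Inf_greatest)
  show ?thesis
    unfolding Lattice.inf_def by (rule some_equality, rule g, rule greatest_unique[OF _ g])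
qed

lemma (in qtop_space) qmodule_opens_mod: "qmodule (opens_mod X)"
proof -
  interpret partial_order "opens_mod X" by (rule partial_order_opens_mod)
  show ?thesis
  proof
    fix U assume U: "U \<subseteq> carrier (opens_mod X)"
    then show "\<exists>s. least (opens_mod X) s (Upper (opens_mod X) U)"
      using opens_mod_sup(1) by auto
    \<comment> \<open>The pointwise meet of an infinite family may fail to be open; the infimum is the join of
      the open lower bounds.\<close>
    let ?L = "Lower (opens_mod X) U"
    have L: "?L \<subseteq> opens X" by (auto simp: Lower_def)
    have "greatest (opens_mod X) (\<lambda>x\<in>carrier X. Sup ((\<lambda>u. u x) ` ?L)) ?L"
      using U opens_Sup[OF L]
      by (auto simp: greatest_def Lower_def intro!: Sup_least Sup_upper)
    then show "\<exists>s. greatest (opens_mod X) s ?L" by blast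
  next
    fix U r assume "U \<subseteq> carrier (opens_mod X)"
    then have U: "U \<subseteq> opens X" "(\<lambda>u. \<lambda>x\<in>carrier X. u x * r) ` U \<subseteq> opens X"
      using opens_mult by auto
    have "Sup S * r = Sup ((\<lambda>s. s * r) ` S)" for S
      using mult_Sup[of r S] by (simp add: mult.commute)
    then show "act (opens_mod X) r (\<Squnion>\<^bsub>opens_mod X\<^esub>U) = \<Squnion>\<^bsub>opens_mod X\<^esub>(act (opens_mod X) r ` U)"
      using opens_mod_sup(2)[OF U(1)] opens_mod_sup(2)[OF U(2)]
      by (auto simp: fun_eq_iff restrict_def image_image)
  next
    fix u R assume "u \<in> carrier (opens_mod X)"
    then have R: "(\<lambda>r. \<lambda>x\<in>carrier X. u x * r) ` R \<subseteq> opens X"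
      using opens_mult by auto
    show "act (opens_mod X) (Sup R) u = \<Squnion>\<^bsub>opens_mod X\<^esub>((\<lambda>r. act (opens_mod X) r u) ` R)"
      using opens_mod_sup(2)[OF R] mult_Sup
      by (auto simp: fun_eq_iff restrict_def image_image)
  next
    fix u r assume u: "u \<in> carrier (opens_mod X)"
    then show "act (opens_mod X) r u \<in> carrier (opens_mod X)"
      using opens_mult by auto
    show "act (opens_mod X) 1 u = u"
      using u opens_mult[of u 1] by (intro opens_eqI) auto
    show "act (opens_mod X) s (act (opens_mod X) r u) = act (opens_mod X) (s * r) u" for s
      by (auto simp: fun_eq_iff restrict_def ac_simps)
  qed
qed

section \<open>Points\<close>

lemma points_iff:
  "p \<in> points A \<longleftrightarrow> p \<in> extensional (carrier A) \<and>
     (\<forall>S\<subseteq>carrier A. p (\<Squnion>\<^bsub>A\<^esub>S) = Sup (p ` S)) \<and>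
     (\<forall>r. \<forall>a\<in>carrier A. p (act A r a) = r * p a) \<and>
     (\<forall>S. finite S \<and> S \<subseteq> carrier A \<longrightarrow> p (\<Sqinter>\<^bsub>A\<^esub>S) = Inf (p ` S))"
  by (auto simp: points_def frm_hom_def qmod_hom_def quantale_mod_sup quantale_mod_inf PiE_def)

text \<open>
  The operations of \<open>O(X)\<close> that a frame-like homomorphism must respect are all computed
  pointwise. So a map into \<open>O(X)\<close> is a homomorphism as soon as each of its evaluations at an
  element of \<open>X\<close> is one, and this reduces statements about homomorphisms into \<open>O(X)\<close> to statements
  about points.
\<close>

lemma (in qtop_space) frm_hom_opens_mod_iff:
  assumes "qmodule A"
  shows "g \<in> frm_hom A (opens_mod X) \<longleftrightarrow>
    g \<in> carrier A \<rightarrow>\<^sub>E opens X \<and> (\<forall>x\<in>carrier X. (\<lambda>a\<in>carrier A. g a x) \<in> points A)"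
proof (cases "g \<in> carrier A \<rightarrow>\<^sub>E opens X")
  case True
  interpret A: qmodule A by fact
  have closed: "g a \<in> opens X" if "a \<in> carrier A" for a
    using True that by auto
  have image: "g ` S \<subseteq> opens X" if "S \<subseteq> carrier A" for S
    using True that by auto
  have eq_iff: "g a = (\<lambda>x\<in>carrier X. v x) \<longleftrightarrow> (\<forall>x\<in>carrier X. g a x = v x)"
    if "a \<in> carrier A" for a v
    using closed[OF that] opens_maps by (auto simp: fun_eq_iff restrict_def PiE_iff extensional_def)
  have restr: "(\<lambda>a\<in>carrier A. g a x) ` S = (\<lambda>u. u x) ` g ` S" if "S \<subseteq> carrier A" for S x
    using that by (auto simp: image_image subset_iff intro!: image_cong)
  have sup: "g (\<Squnion>\<^bsub>A\<^esub>S) = \<Squnion>\<^bsub>opens_mod X\<^esub>(g ` S) \<longleftrightarrow>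
      (\<forall>x\<in>carrier X. (\<lambda>a\<in>carrier A. g a x) (\<Squnion>\<^bsub>A\<^esub>S) = Sup ((\<lambda>a\<in>carrier A. g a x) ` S))"
    if "S \<subseteq> carrier A" for S
    unfolding opens_mod_sup(2)[OF image[OF that]] restr[OF that] using that by (simp add: eq_iff)
  have inf: "g (\<Sqinter>\<^bsub>A\<^esub>S) = \<Sqinter>\<^bsub>opens_mod X\<^esub>(g ` S) \<longleftrightarrow>
      (\<forall>x\<in>carrier X. (\<lambda>a\<in>carrier A. g a x) (\<Sqinter>\<^bsub>A\<^esub>S) = Inf ((\<lambda>a\<in>carrier A. g a x) ` S))"
    if "finite S" "S \<subseteq> carrier A" for S
    unfolding opens_mod_inf[OF finite_imageI[OF that(1)] image[OF that(2)]] restr[OF that(2)]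
    using that by (simp add: eq_iff)
  have act: "g (act A r a) = act (opens_mod X) r (g a) \<longleftrightarrow>
      (\<forall>x\<in>carrier X. (\<lambda>a\<in>carrier A. g a x) (act A r a) = r * (\<lambda>a\<in>carrier A. g a x) a)"
    if "a \<in> carrier A" for r a
    using that by (simp add: eq_iff A.act_closed mult.commute)
  show ?thesis
    unfolding frm_hom_def qmod_hom_def points_iff mem_Collect_eq
    using True sup inf act by (simp cong: conj_cong imp_cong) blast
next
  case False
  then show ?thesis by (auto simp: frm_hom_def qmod_hom_def)
qed

text \<open>
  The identity of \<open>O(X)\<close> is a homomorphism, and the pointwise criterion at \<open>x\<close> turns it into
  evaluation at \<open>x\<close>. Sending \<open>x\<close> to this point is the unit of the adjunction.
\<close>

lemma (in qtop_space) evaluation_point: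
  assumes "x \<in> carrier X"
  shows "(\<lambda>u\<in>opens X. u x) \<in> points (opens_mod X)"
proof -
  have "(\<lambda>u\<in>opens X. (\<lambda>u\<in>opens X. u) u x) \<in> points (opens_mod X)"
    using id_frm_hom[OF qmodule_opens_mod] assms
    by (simp add: frm_hom_opens_mod_iff[OF qmodule_opens_mod] del: restrict_apply)
  then show ?thesis by (simp cong: restrict_cong)
qed

lemma compose_point:
  assumes "qmodule A" "g \<in> frm_hom A B" "p \<in> points B"
  shows "compose (carrier A) p g \<in> points A"
  using compose_frm_hom[OF assms(1,2)] assms(3) by (simp add: points_def)

lemma pt_simps [simp]:
  "carrier (pt A) = points A"
  "opens (pt A) = (\<lambda>a. \<lambda>p\<in>points A. p a) ` carrier A"
  by (simp_all add: pt_def)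

text \<open>
  Since points preserve joins, finite meets and the action, \<open>a \<mapsto> (\<lambda>p. p a)\<close> turns these
  operations of \<open>A\<close> into the pointwise ones, so its image is closed under them.
\<close>

lemma (in qmodule) qtop_space_pt: "qtop_space (pt A)"
proof
  show "opens (pt A) \<subseteq> carrier (pt A) \<rightarrow>\<^sub>E UNIV"
    by auto
next
  have "\<Sqinter>\<^bsub>A\<^esub>{} \<in> carrier A" by simp
  moreover have "(\<lambda>p\<in>points A. Orderings.top) = (\<lambda>p\<in>points A. p (\<Sqinter>\<^bsub>A\<^esub>{}))"
    by (auto simp: points_iff fun_eq_iff restrict_def)
  ultimately show "(\<lambda>p\<in>carrier (pt A). Orderings.top) \<in> opens (pt A)"
    by auto
next
  fix u v assume "u \<in> opens (pt A)" "v \<in> opens (pt A)"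
  then obtain a b where ab: "a \<in> carrier A" "b \<in> carrier A"
    and uv: "u = (\<lambda>p\<in>points A. p a)" "v = (\<lambda>p\<in>points A. p b)"
    by auto
  have "p (\<Sqinter>\<^bsub>A\<^esub>{a, b}) = Lattices.inf (p a) (p b)" if "p \<in> points A" for p
  proof -
    have "finite {a, b}" "{a, b} \<subseteq> carrier A"
      using ab by auto
    then have "p (\<Sqinter>\<^bsub>A\<^esub>{a, b}) = Inf (p ` {a, b})"
      using that unfolding points_iff by blast
    then show ?thesis by simp
  qed
  then have "(\<lambda>p\<in>carrier (pt A). Lattices.inf (u p) (v p)) = (\<lambda>p\<in>points A. p (\<Sqinter>\<^bsub>A\<^esub>{a, b}))"
    by (auto simp: uv fun_eq_iff restrict_def)
  then show "(\<lambda>p\<in>carrier (pt A). Lattices.inf (u p) (v p)) \<in> opens (pt A)"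
    using ab by auto
next
  fix U assume "U \<subseteq> opens (pt A)"
  then obtain S where S: "S \<subseteq> carrier A" and U: "U = (\<lambda>a. \<lambda>p\<in>points A. p a) ` S"
    by (auto simp: subset_image_iff)
  have "(\<lambda>p\<in>carrier (pt A). Sup ((\<lambda>u. u p) ` U)) = (\<lambda>p\<in>points A. p (\<Squnion>\<^bsub>A\<^esub>S))"
    using S by (auto simp: U points_iff fun_eq_iff restrict_def image_image)
  then show "(\<lambda>p\<in>carrier (pt A). Sup ((\<lambda>u. u p) ` U)) \<in> opens (pt A)"
    using S by auto
next
  fix u r assume "u \<in> opens (pt A)"
  then obtain a where a: "a \<in> carrier A" and u: "u = (\<lambda>p\<in>points A. p a)"
    by auto
  have "(\<lambda>p\<in>carrier (pt A). u p * r) = (\<lambda>p\<in>points A. p (act A r a))"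
    using a by (auto simp: u points_iff fun_eq_iff restrict_def mult.commute)
  then show "(\<lambda>p\<in>carrier (pt A). u p * r) \<in> opens (pt A)"
    using a act_closed by auto
qed

section \<open>Functoriality\<close>

lemma cont_mapsD:
  assumes "f \<in> cont_maps X Y"
  shows "f \<in> carrier X \<rightarrow> carrier Y" "v \<in> opens Y \<Longrightarrow> compose (carrier X) v f \<in> opens X"
  using assms by (auto simp: cont_maps_def)

lemma opens_map_frm_hom:
  assumes "qtop_space X" "qtop_space Y" "f \<in> cont_maps X Y"
  shows "opens_map X Y f \<in> frm_hom (opens_mod Y) (opens_mod X)"
proof -
  interpret X: qtop_space X by fact
  interpret Y: qtop_space Y by fact
  \<comment> \<open>Evaluating \<open>O(f)\<close> at \<open>x\<close> gives evaluation at \<open>f x\<close>, which is a point of \<open>O(Y)\<close>.\<close>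
  have "(\<lambda>v\<in>opens Y. opens_map X Y f v x) = (\<lambda>v\<in>opens Y. v (f x))" if "x \<in> carrier X" for x
    using that by (auto simp: opens_map_def compose_eq fun_eq_iff restrict_def)
  then show ?thesis
    using cont_mapsD[OF assms(3)] Y.evaluation_point
    by (auto simp: X.frm_hom_opens_mod_iff[OF Y.qmodule_opens_mod] opens_map_def Pi_iff)
qed

lemma opens_map_id:
  assumes "qtop_space X"
  shows "opens_map X X (\<lambda>x\<in>carrier X. x) = (\<lambda>u\<in>opens X. u)"
proof -
  have "compose (carrier X) u (\<lambda>x\<in>carrier X. x) = u" if "u \<in> opens X" for u
    using qtop_space.opens_maps[OF assms] that by (intro compose_Id) (auto simp: PiE_iff)
  then show ?thesis by (simp add: opens_map_def cong: restrict_cong)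
qed

lemma opens_map_compose:
  assumes "f \<in> cont_maps X Y" "g \<in> cont_maps Y Z"
  shows "opens_map X Z (compose (carrier X) g f) =
    compose (opens Z) (opens_map X Y f) (opens_map Y Z g)"
  unfolding opens_map_def compose_def[of "opens Z"]
  using cont_mapsD[OF assms(1)] cont_mapsD[OF assms(2)]
  by (intro restrict_ext) (simp add: compose_assoc)

text \<open>The preimage of the open set of \<open>a\<close> under \<open>pt(g)\<close> is the open set of \<open>g a\<close>.\<close>

lemma pt_map_cont:
  assumes "qmodule A" "g \<in> frm_hom A B"
  shows "pt_map A B g \<in> cont_maps (pt B) (pt A)"
proof -
  have g: "g a \<in> carrier B" if "a \<in> carrier A" for a
    using assms(2) that by (auto simp: frm_hom_def qmod_hom_def)
  have "compose (points B) (\<lambda>p\<in>points A. p a) (pt_map A B g) = (\<lambda>p\<in>points B. p (g a))"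
    if "a \<in> carrier A" for a
    using that compose_point[OF assms]
    by (auto simp: compose_def pt_map_def fun_eq_iff restrict_def)
  then show ?thesis
    using g compose_point[OF assms] by (auto simp: cont_maps_def) (auto simp: pt_map_def)
qed

lemma pt_map_id: "pt_map A A (\<lambda>a\<in>carrier A. a) = (\<lambda>p\<in>points A. p)"
proof -
  have "compose (carrier A) p (\<lambda>a\<in>carrier A. a) = p" if "p \<in> points A" for p
    using that by (intro compose_Id) (auto simp: points_iff)
  then show ?thesis by (simp add: pt_map_def cong: restrict_cong)
qed

lemma pt_map_compose:
  assumes "qmodule B" "f \<in> frm_hom A B" "g \<in> frm_hom B C"
  shows "pt_map A C (compose (carrier A) g f) =
    compose (points C) (pt_map A B f) (pt_map B C g)"
proof -
  have "f \<in> carrier A \<rightarrow> carrier B"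
    using assms(2) by (auto simp: frm_hom_def qmod_hom_def)
  then show ?thesis
    unfolding pt_map_def compose_def[of "points C"]
    using compose_point[OF assms(1,3)]
    by (intro restrict_ext) (simp add: compose_assoc)
qed

section \<open>Transposition\<close>

text \<open>
  A map \<open>h\<close> into \<open>pt A\<close> and a map \<open>k\<close> into \<open>O(X)\<close> are two ways to read one function of two
  arguments. That \<open>h x\<close> is a point for each \<open>x\<close> says, by the pointwise criterion, that \<open>k\<close> is a
  homomorphism; that the preimage under \<open>h\<close> of the open set of \<open>a\<close> is open says that \<open>k a\<close> is open.
\<close>

lemma adj_transpose_bij:
  fixes X :: "('q::comm_unital_quantale, 'x) qspace" and A :: "('q, 'a) qmod"
  assumes "qtop_space X" "qmodule A"
  shows "bij_betw (adj_transpose X A) (cont_maps X (pt A)) (frm_hom A (opens_mod X))"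
proof -
  interpret X: qtop_space X by fact
  interpret A: qmodule A by fact
  define untranspose where
    "untranspose k = (\<lambda>x\<in>carrier X. \<lambda>a\<in>carrier A. k a x)" for k :: "'a \<Rightarrow> 'x \<Rightarrow> 'q"
  have preimage: "compose (carrier X) (\<lambda>p\<in>points A. p a) h = (\<lambda>x\<in>carrier X. h x a)"
    if "h \<in> carrier X \<rightarrow> points A" for h a
    using that by (auto simp: compose_def fun_eq_iff restrict_def)
  have cont_iff: "h \<in> cont_maps X (pt A) \<longleftrightarrow>
      h \<in> carrier X \<rightarrow>\<^sub>E points A \<and> (\<forall>a\<in>carrier A. (\<lambda>x\<in>carrier X. h x a) \<in> opens X)" for h
    by (auto simp: cont_maps_def preimage PiE_iff)
  have point_restrict: "(\<lambda>a\<in>carrier A. p a) = p" if "p \<in> points A" for p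
    using that by (auto simp: points_iff extensional_restrict)
  have open_restrict: "(\<lambda>x\<in>carrier X. u x) = u" if "u \<in> opens X" for u
    using that X.opens_maps by (auto simp: PiE_iff extensional_restrict)
  note hom_iff = X.frm_hom_opens_mod_iff[OF assms(2)]
  show ?thesis
  proof (rule bij_betw_byWitness[where f' = untranspose])
    show "\<forall>h\<in>cont_maps X (pt A). untranspose (adj_transpose X A h) = h"
    proof
      fix h assume h: "h \<in> cont_maps X (pt A)"
      then have "untranspose (adj_transpose X A h) = (\<lambda>x\<in>carrier X. \<lambda>a\<in>carrier A. h x a)"
        by (auto simp: untranspose_def adj_transpose_def fun_eq_iff restrict_def)
      also have "\<dots> = (\<lambda>x\<in>carrier X. h x)"
        using h by (intro restrict_ext point_restrict) (auto simp: cont_iff)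
      also have "\<dots> = h"
        using h by (auto simp: cont_iff PiE_iff extensional_restrict)
      finally show "untranspose (adj_transpose X A h) = h" .
    qed
    show "\<forall>k\<in>frm_hom A (opens_mod X). adj_transpose X A (untranspose k) = k"
    proof
      fix k assume k: "k \<in> frm_hom A (opens_mod X)"
      then have "adj_transpose X A (untranspose k) = (\<lambda>a\<in>carrier A. \<lambda>x\<in>carrier X. k a x)"
        by (auto simp: untranspose_def adj_transpose_def fun_eq_iff restrict_def)
      also have "\<dots> = (\<lambda>a\<in>carrier A. k a)"
        using k by (intro restrict_ext open_restrict) (auto simp: hom_iff)
      also have "\<dots> = k"
        using k by (auto simp: hom_iff PiE_iff extensional_restrict)
      finally show "adj_transpose X A (untranspose k) = k" .
    qed
    show "adj_transpose X A ` cont_maps X (pt A) \<subseteq> frm_hom A (opens_mod X)"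
    proof (rule image_subsetI)
      fix h assume h: "h \<in> cont_maps X (pt A)"
      have "(\<lambda>a\<in>carrier A. adj_transpose X A h a x) = (\<lambda>a\<in>carrier A. h x a)"
        if "x \<in> carrier X" for x
        using that by (auto simp: adj_transpose_def fun_eq_iff restrict_def)
      then show "adj_transpose X A h \<in> frm_hom A (opens_mod X)"
        using h by (auto simp: hom_iff cont_iff point_restrict PiE_iff) (auto simp: adj_transpose_def)
    qed
    show "untranspose ` frm_hom A (opens_mod X) \<subseteq> cont_maps X (pt A)"
    proof (rule image_subsetI)
      fix k assume k: "k \<in> frm_hom A (opens_mod X)"
      have "(\<lambda>x\<in>carrier X. untranspose k x a) = (\<lambda>x\<in>carrier X. k a x)"
        if "a \<in> carrier A" for a
        using that by (auto simp: untranspose_def fun_eq_iff restrict_def)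
      then show "untranspose k \<in> cont_maps X (pt A)"
        using k by (auto simp: hom_iff cont_iff open_restrict PiE_iff) (auto simp: untranspose_def)
    qed
  qed
qed

lemma adj_transpose_natural_space:
  assumes "f \<in> cont_maps Y X" "h \<in> cont_maps X (pt A)"
  shows "adj_transpose Y A (compose (carrier Y) h f) =
    compose (carrier A) (opens_map Y X f) (adj_transpose X A h)"
proof -
  \<comment> \<open>\<open>opens_map\<close> is \<open>undefined\<close> off the open sets, so the argument it receives must be open.\<close>
  have "adj_transpose X A h a \<in> opens X" if "a \<in> carrier A" for a
  proof -
    have "compose (carrier X) (\<lambda>p\<in>points A. p a) h \<in> opens X"
      using that by (intro cont_mapsD(2)[OF assms(2)]) auto
    moreover have "compose (carrier X) (\<lambda>p\<in>points A. p a) h = adj_transpose X A h a"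
      using that cont_mapsD(1)[OF assms(2)]
      by (auto simp: adj_transpose_def compose_def fun_eq_iff restrict_def)
    ultimately show ?thesis by simp
  qed
  then show ?thesis
    using cont_mapsD(1)[OF assms(1)]
    by (auto simp: opens_map_def fun_eq_iff restrict_def compose_def adj_transpose_def Pi_iff)
qed

lemma adj_transpose_natural_module:
  assumes "g \<in> frm_hom B A" "h \<in> cont_maps X (pt A)"
  shows "adj_transpose X B (compose (carrier X) (pt_map B A g) h) =
    compose (carrier B) (adj_transpose X A h) g"
proof -
  have "g \<in> carrier B \<rightarrow> carrier A"
    using assms(1) by (auto simp: frm_hom_def qmod_hom_def)
  then show ?thesis
    using cont_mapsD(1)[OF assms(2)]
    by (auto simp: adj_transpose_def compose_def pt_map_def fun_eq_iff restrict_def Pi_iff)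
qed

theorem proposition3p4:
  fixes X :: "('q::comm_unital_quantale, 'x) qspace"
    and Y :: "('q, 'y) qspace"
    and Z :: "('q, 'z) qspace"
    and A :: "('q, 'a) qmod"
    and B :: "('q, 'b) qmod"
    and C :: "('q, 'c) qmod"
  assumes "qtop_space X" and "qtop_space Y" and "qtop_space Z"
    and "qmodule A" and "qmodule B" and "qmodule C"
  shows "(qmodule (opens_mod X) \<and>
      (\<forall>f \<in> cont_maps X Y. opens_map X Y f \<in> frm_hom (opens_mod Y) (opens_mod X)) \<and>
      opens_map X X (\<lambda>x\<in>carrier X. x) = (\<lambda>u\<in>carrier (opens_mod X). u) \<and>
      (\<forall>f \<in> cont_maps X Y. \<forall>g \<in> cont_maps Y Z.
        opens_map X Z (compose (carrier X) g f) =
        compose (carrier (opens_mod Z)) (opens_map X Y f) (opens_map Y Z g))) \<and>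
    (qtop_space (pt A) \<and>
      (\<forall>f \<in> frm_hom A B. pt_map A B f \<in> cont_maps (pt B) (pt A)) \<and>
      pt_map A A (\<lambda>a\<in>carrier A. a) = (\<lambda>p\<in>carrier (pt A). p) \<and>
      (\<forall>f \<in> frm_hom A B. \<forall>g \<in> frm_hom B C.
        pt_map A C (compose (carrier A) g f) =
        compose (carrier (pt C)) (pt_map A B f) (pt_map B C g))) \<and>
    bij_betw (adj_transpose X A) (cont_maps X (pt A)) (frm_hom A (opens_mod X)) \<and>
    (\<forall>f \<in> cont_maps Y X. \<forall>h \<in> cont_maps X (pt A).
      adj_transpose Y A (compose (carrier Y) h f) =
      compose (carrier A) (opens_map Y X f) (adj_transpose X A h)) \<and>
    (\<forall>g \<in> frm_hom B A. \<forall>h \<in> cont_maps X (pt A).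
      adj_transpose X B (compose (carrier X) (pt_map B A g) h) =
      compose (carrier B) (adj_transpose X A h) g)"
  using assms
  \<comment> \<open>The left-hand side of naturality in the module also matches that of naturality in the space,
    with \<open>h\<close> in the part of \<open>f\<close> and \<open>pt(g)\<close> in that of \<open>h\<close>. As rewrite rules the two laws would
    interfere.\<close>
  by (intro conjI ballI)
    ((rule adj_transpose_natural_space adj_transpose_natural_module; assumption) |
     simp add: qtop_space.qmodule_opens_mod opens_map_frm_hom opens_map_id opens_map_compose
      qmodule.qtop_space_pt pt_map_cont pt_map_id pt_map_compose adj_transpose_bij
      del: pt_simps(2))+

end
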